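(* Let $P$ be a finite poset and $k[P]$ the incidence algebra of $P$ over a field $k$. Let $M$ be a $k[P]$-module and let $f\colon X=\bigoplus_{i=1}^m X_i \to M$ be its interval cover, where all the $X_i$ are interval modules. Then the following hold. (1) $f$ is surjective. (2) $f|_{X_i}\colon X_i\to M$ is injective for every $i\in\{1,\ldots,m\}$. (3) The supports of $M$ and $X$ coincide. In particular, every $X_i$ can be taken as an interval submodule of $M$ (a submodule of $M$ that is an interval module).
   Context: For a finite poset $P$, the Hasse diagram of $P$ is the quiver with vertex set $P$ and an arrow $x\to y$ if and only if $x<y$ and there is no $z\in P$ with $x<z<y$. The incidence algebra $k[P]$ is the quotient of the path algebra over $k$ of the Hasse diagram by the two-sided ideal generated by all commutativity relations (differences of parallel paths). All modules are finitely generated right modules; $k[P]$-modules are identified with functors from $P$ (viewed as a category with a unique morphism $a\to b$ iff $a\le b$) to finite dimensional $k$-vector spaces, given by $M_a$ ($a\in P$) and $M(a\le b)\colon M_a\to M_b$. The support of $M$ is $\mathrm{supp}\,M=\{a\in P\mid M_a\neq 0\}$. A full subposet is a subset with the induced order. An interval of $P$ is a (nonempty) full subposet $I$ which is connected as a poset and convex in $P$ (if $x,y\in I$, $z\in P$ and $x<z<y$, then $z\in I$). For an interval $I$, the module $k_I$ has $(k_I)_a=k$ if $a\in I$ and $0$ otherwise, and $k_I(a\le b)=1_k$ if $a,b\in I$ and $0$ otherwise. An interval module is a module isomorphic to some $k_I$. A module is interval-decomposable if it is isomorphic to a finite direct sum of interval modules. An interval cover of $M$ is a morphism $f\colon X\to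 M$ with $X$ interval-decomposable such that (i) for every interval-decomposable $Y$ the map $\mathrm{Hom}(Y,f)\colon \mathrm{Hom}(Y,X)\to\mathrm{Hom}(Y,M)$ is surjective, and (ii) $f$ is right minimal: every $g\colon X\to X$ with $fg=f$ is an isomorphism. Every module has an interval cover, unique up to isomorphism. *)

theory Defs
  imports Complex_Main "HOL-Library.Function_Algebras"
begin

text \<open>
  A finite poset is a finite set \<open>P\<close> in a type of class \<^class>\<open>order\<close>, with the induced order.
  A \<open>k[P]\<close>-module is a functor from \<open>P\<close> to finite-dimensional \<open>k\<close>-vector spaces. Its spaces are
  subspaces \<open>fib M a\<close> of one ambient \<open>k\<close>-vector space, given by a type \<open>'v\<close> together with a scalar
  multiplication \<open>s\<close>; this is no restriction, since any family of vector spaces embeds into its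
  direct sum. Only points of \<open>P\<close>, pairs \<open>a \<le> b\<close> in \<open>P\<close> and vectors of the fibres matter: all
  functions are arbitrary elsewhere.
\<close>

record ('p, 'v) pmod =
  fib :: "'p \<Rightarrow> 'v set"
  tr :: "'p \<Rightarrow> 'p \<Rightarrow> 'v \<Rightarrow> 'v"

definition linear_between ::
  "('k::field \<Rightarrow> 'v::ab_group_add \<Rightarrow> 'v) \<Rightarrow> 'v set \<Rightarrow> ('k \<Rightarrow> 'w::ab_group_add \<Rightarrow> 'w) \<Rightarrow> 'w set
    \<Rightarrow> ('v \<Rightarrow> 'w) \<Rightarrow> bool" where
  "linear_between s V t W h \<longleftrightarrow>
     (\<forall>x\<in>V. h x \<in> W) \<and>
     (\<forall>x\<in>V. \<forall>y\<in>V. h (x + y) = h x + h y) \<and>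
     (\<forall>c. \<forall>x\<in>V. h (s c x) = t c (h x))"

definition pmodule ::
  "'p::order set \<Rightarrow> ('k::field \<Rightarrow> 'v::ab_group_add \<Rightarrow> 'v) \<Rightarrow> ('p, 'v) pmod \<Rightarrow> bool" where
  "pmodule P s M \<longleftrightarrow>
     vector_space s \<and>
     (\<forall>a\<in>P. module.subspace s (fib M a) \<and>
            (\<exists>B. finite B \<and> fib M a \<subseteq> module.span s B)) \<and>
     (\<forall>a\<in>P. \<forall>b\<in>P. a \<le> b \<longrightarrow> linear_between s (fib M a) s (fib M b) (tr M a b)) \<and>
     (\<forall>a\<in>P. \<forall>x\<in>fib M a. tr M a a x = x) \<and>
     (\<forall>a\<in>P. \<forall>b\<in>P. \<forall>c\<in>P. a \<le> b \<longrightarrow> b \<le> c \<longrightarrow>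
        (\<forall>x\<in>fib M a. tr M b c (tr M a b x) = tr M a c x))"

definition support :: "'p::order set \<Rightarrow> ('p, 'v::ab_group_add) pmod \<Rightarrow> 'p set" where
  "support P M = {a \<in> P. fib M a \<noteq> {0}}"

definition pmod_hom ::
  "'p::order set \<Rightarrow> ('k::field \<Rightarrow> 'v::ab_group_add \<Rightarrow> 'v) \<Rightarrow> ('p, 'v) pmod
    \<Rightarrow> ('k \<Rightarrow> 'w::ab_group_add \<Rightarrow> 'w) \<Rightarrow> ('p, 'w) pmod \<Rightarrow> ('p \<Rightarrow> 'v \<Rightarrow> 'w) \<Rightarrow> bool" where
  "pmod_hom P s M t N g \<longleftrightarrow>
     (\<forall>a\<in>P. linear_between s (fib M a) t (fib N a) (g a)) \<and>
     (\<forall>a\<in>P. \<forall>b\<in>P. a \<le> b \<longrightarrow> (\<forall>x\<in>fib M a. g b (tr M a b x) = tr N a b (g a x)))"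

definition pmod_inj :: "'p::order set \<Rightarrow> ('p, 'v) pmod \<Rightarrow> ('p \<Rightarrow> 'v \<Rightarrow> 'w) \<Rightarrow> bool" where
  "pmod_inj P M g \<longleftrightarrow> (\<forall>a\<in>P. inj_on (g a) (fib M a))"

definition pmod_surj ::
  "'p::order set \<Rightarrow> ('p, 'v) pmod \<Rightarrow> ('p, 'w) pmod \<Rightarrow> ('p \<Rightarrow> 'v \<Rightarrow> 'w) \<Rightarrow> bool" where
  "pmod_surj P M N g \<longleftrightarrow> (\<forall>a\<in>P. g a ` fib M a = fib N a)"

definition pmod_iso ::
  "'p::order set \<Rightarrow> ('k::field \<Rightarrow> 'v::ab_group_add \<Rightarrow> 'v) \<Rightarrow> ('p, 'v) pmod
    \<Rightarrow> ('k \<Rightarrow> 'w::ab_group_add \<Rightarrow> 'w) \<Rightarrow> ('p, 'w) pmod \<Rightarrow> ('p \<Rightarrow> 'v \<Rightarrow> 'w) \<Rightarrow> bool" where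
  "pmod_iso P s M t N g \<longleftrightarrow> pmod_hom P s M t N g \<and> pmod_inj P M g \<and> pmod_surj P M N g"

definition submodule ::
  "'p::order set \<Rightarrow> ('k::field \<Rightarrow> 'v::ab_group_add \<Rightarrow> 'v) \<Rightarrow> ('p, 'v) pmod
    \<Rightarrow> ('p, 'v) pmod \<Rightarrow> bool" where
  "submodule P s N M \<longleftrightarrow>
     pmodule P s N \<and>
     (\<forall>a\<in>P. fib N a \<subseteq> fib M a) \<and>
     (\<forall>a\<in>P. \<forall>b\<in>P. a \<le> b \<longrightarrow> (\<forall>x\<in>fib N a. tr N a b x = tr M a b x))"

text \<open>The external direct sum of \<open>X 0, \<dots>, X (m - 1)\<close> consists of sequences vanishing from \<open>m\<close> on.\<close>

definition scale_seq :: "('k \<Rightarrow> 'v \<Rightarrow> 'v) \<Rightarrow> 'k \<Rightarrow> (nat \<Rightarrow> 'v) \<Rightarrow> (nat \<Rightarrow> 'v)" where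
  "scale_seq s c x = (\<lambda>i. s c (x i))"

definition direct_sum ::
  "nat \<Rightarrow> (nat \<Rightarrow> ('p, 'v::ab_group_add) pmod) \<Rightarrow> ('p, nat \<Rightarrow> 'v) pmod" where
  "direct_sum m X =
     \<lparr>fib = (\<lambda>a. {x. (\<forall>i<m. x i \<in> fib (X i) a) \<and> (\<forall>i\<ge>m. x i = 0)}),
      tr = (\<lambda>a b x i. if i < m then tr (X i) a b (x i) else 0)\<rparr>"

definition summand_incl :: "nat \<Rightarrow> 'v::ab_group_add \<Rightarrow> (nat \<Rightarrow> 'v)" where
  "summand_incl i x = (\<lambda>j. if j = i then x else 0)"

definition poset_connected :: "'p::order set \<Rightarrow> bool" where
  "poset_connected I \<longleftrightarrow>
     (\<forall>x\<in>I. \<forall>y\<in>I. (x, y) \<in> {(u, v). u \<in> I \<and> v \<in> I \<and> (u \<le> v \<or> v \<le> u)}\<^sup>*)"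

definition interval :: "'p::order set \<Rightarrow> 'p set \<Rightarrow> bool" where
  "interval P I \<longleftrightarrow>
     I \<noteq> {} \<and> I \<subseteq> P \<and> poset_connected I \<and>
     (\<forall>x\<in>I. \<forall>y\<in>I. \<forall>z\<in>P. x < z \<and> z < y \<longrightarrow> z \<in> I)"

definition kmod :: "'p::order set \<Rightarrow> ('p, 'k::field) pmod" where
  "kmod I =
     \<lparr>fib = (\<lambda>a. if a \<in> I then UNIV else {0}),
      tr = (\<lambda>a b x. if a \<in> I \<and> b \<in> I then x else 0)\<rparr>"

definition interval_module ::
  "'p::order set \<Rightarrow> ('k::field \<Rightarrow> 'v::ab_group_add \<Rightarrow> 'v) \<Rightarrow> ('p, 'v) pmod \<Rightarrow> bool" where
  "interval_module P s M \<longleftrightarrow>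
     pmodule P s M \<and> (\<exists>I g. interval P I \<and> pmod_iso P (*) (kmod I) s M g)"

definition interval_decomposable ::
  "'p::order set \<Rightarrow> ('k::field \<Rightarrow> 'v::ab_group_add \<Rightarrow> 'v) \<Rightarrow> ('p, 'v) pmod \<Rightarrow> bool" where
  "interval_decomposable P s M \<longleftrightarrow>
     pmodule P s M \<and>
     (\<exists>m I g. (\<forall>i<m. interval P (I i)) \<and>
        pmod_iso P (scale_seq (*)) (direct_sum m (\<lambda>i. kmod (I i))) s M g)"

text \<open>
  A definition cannot quantify over the type carrying the test modules \<open>Y\<close>. They range over the
  modules inside the space of sequences in \<open>k\<close>, which contains a copy of every
  interval-decomposable module; lemma \<open>interval_cover_lift\<close> below recovers condition (i) for \<open>Y\<close>
  carried by an arbitrary type.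
\<close>

definition interval_cover ::
  "'p::order set \<Rightarrow> ('k::field \<Rightarrow> 'w::ab_group_add \<Rightarrow> 'w) \<Rightarrow> ('p, 'w) pmod
    \<Rightarrow> ('k \<Rightarrow> 'v::ab_group_add \<Rightarrow> 'v) \<Rightarrow> ('p, 'v) pmod \<Rightarrow> ('p \<Rightarrow> 'w \<Rightarrow> 'v) \<Rightarrow> bool" where
  "interval_cover P t X s M f \<longleftrightarrow>
     pmodule P s M \<and> interval_decomposable P t X \<and> pmod_hom P t X s M f \<and>
     (\<forall>(r :: 'k \<Rightarrow> (nat \<Rightarrow> 'k) \<Rightarrow> (nat \<Rightarrow> 'k)) Y h.
        interval_decomposable P r Y \<longrightarrow> pmod_hom P r Y s M h \<longrightarrow>
        (\<exists>g. pmod_hom P r Y t X g \<and> (\<forall>a\<in>P. \<forall>y\<in>fib Y a. f a (g a y) = h a y))) \<and>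
     (\<forall>g. pmod_hom P t X t X g \<longrightarrow> (\<forall>a\<in>P. \<forall>x\<in>fib X a. f a (g a x) = f a x) \<longrightarrow>
        pmod_iso P t X t X g)"


lemma vector_space_scale_seq: "vector_space s \<Longrightarrow> vector_space (scale_seq s)"
  unfolding vector_space_def scale_seq_def by (auto simp: fun_eq_iff)

lemma vector_space_mult: "vector_space ((*) :: 'k::field \<Rightarrow> 'k \<Rightarrow> 'k)"
  by unfold_locales (auto simp: algebra_simps)

lemma pmodule_direct_sum_kmod:
  fixes I :: "nat \<Rightarrow> 'p::order set"
  assumes conv: "\<forall>i<m. interval P (I i)"
  shows "pmodule P (scale_seq ((*) :: 'k::field \<Rightarrow> 'k \<Rightarrow> 'k)) (direct_sum m (\<lambda>i. kmod (I i)))"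
proof -
  let ?s = "scale_seq ((*) :: 'k \<Rightarrow> 'k \<Rightarrow> 'k)"
  let ?D = "direct_sum m (\<lambda>i. kmod (I i)) :: ('p, nat \<Rightarrow> 'k) pmod"
  let ?e = "\<lambda>i. summand_incl i (1::'k)"
  have vs: "vector_space ?s"
    by (rule vector_space_scale_seq[OF vector_space_mult])
  then have md: "module ?s"
    by (simp add: module_def vector_space_def)
  have sub: "module.subspace ?s (fib ?D a)" for a
    unfolding module.subspace_def[OF md]
    by (auto simp: direct_sum_def kmod_def scale_seq_def split: if_splits)
  have "fib ?D a \<subseteq> module.span ?s (?e ` {..<m})" for a
  proof
    fix x assume x: "x \<in> fib ?D a"
    have "x = (\<Sum>i<m. ?s (x i) (?e i))"
    proof
      fix j
      have "(\<Sum>i<m. ?s (x i) (?e i)) j = (\<Sum>i<m. ?s (x i) (?e i) j)"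
        by (induction m) simp_all
      also have "\<dots> = (\<Sum>i<m. if i = j then x i else 0)"
        by (rule sum.cong) (auto simp: scale_seq_def summand_incl_def)
      also have "\<dots> = x j"
        using x by (auto simp: direct_sum_def)
      finally show "x j = (\<Sum>i<m. ?s (x i) (?e i)) j" by simp
    qed
    also have "\<dots> \<in> module.span ?s (?e ` {..<m})"
      by (intro module.span_sum[OF md] module.span_scale[OF md] module.span_base[OF md]) auto
    finally show "x \<in> module.span ?s (?e ` {..<m})" .
  qed
  then have fd: "\<exists>B. finite B \<and> fib ?D a \<subseteq> module.span ?s B" for a
    by blast
  have lin: "linear_between ?s (fib ?D a) ?s (fib ?D b) (tr ?D a b)" for a b
    by (auto simp: linear_between_def direct_sum_def kmod_def scale_seq_def fun_eq_iff
        split: if_splits)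
  have idn: "tr ?D a a x = x" if "x \<in> fib ?D a" for a x
    using that by (auto simp: direct_sum_def kmod_def fun_eq_iff split: if_splits)
  have comp: "tr ?D b c (tr ?D a b x) = tr ?D a c x"
    if "a \<le> b" "b \<le> c" "b \<in> P" "x \<in> fib ?D a" for a b c x
  proof -
    have "b \<in> I i" if "i < m" "a \<in> I i" "c \<in> I i" for i
      using conv that \<open>a \<le> b\<close> \<open>b \<le> c\<close> \<open>b \<in> P\<close> unfolding interval_def
      by (metis order_le_less)
    then show ?thesis
      by (auto simp: direct_sum_def kmod_def fun_eq_iff)
  qed
  show ?thesis
    unfolding pmodule_def using vs sub fd lin idn comp by blast
qed

lemma interval_cover_lift:
  fixes r :: "'k::field \<Rightarrow> 'u::ab_group_add \<Rightarrow> 'u" and P :: "'p::order set"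
  assumes cover: "interval_cover P t X s M f"
    and Y: "interval_decomposable P r Y"
    and h: "pmod_hom P r Y s M h"
  shows "\<exists>g. pmod_hom P r Y t X g \<and> (\<forall>a\<in>P. \<forall>y\<in>fib Y a. f a (g a y) = h a y)"
proof -
  let ?s = "scale_seq ((*) :: 'k \<Rightarrow> 'k \<Rightarrow> 'k)"
  obtain m :: nat and I e where I: "\<forall>i<m. interval P (I i)"
    and e: "pmod_iso P ?s (direct_sum m (\<lambda>i. kmod (I i))) r Y e"
    using Y unfolding interval_decomposable_def by blast
  define D where "D = (direct_sum m (\<lambda>i. kmod (I i)) :: ('p, nat \<Rightarrow> 'k) pmod)"
  have e: "pmod_hom P ?s D r Y e" and bij: "\<And>a. a \<in> P \<Longrightarrow> bij_betw (e a) (fib D a) (fib Y a)"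
    using e by (auto simp: D_def pmod_iso_def pmod_inj_def pmod_surj_def bij_betw_def)
  have pmD: "pmodule P ?s D"
    unfolding D_def by (rule pmodule_direct_sum_kmod[OF I])
  have "pmod_iso P ?s D ?s D (\<lambda>a x. x)"
    using pmD by (auto simp: pmod_iso_def pmod_hom_def pmod_inj_def pmod_surj_def linear_between_def)
  then have D: "interval_decomposable P ?s D"
    unfolding interval_decomposable_def using pmD I D_def by blast
  have eD: "e a x \<in> fib Y a" if "a \<in> P" "x \<in> fib D a" for a x
    using bij that bij_betwE by blast
  have "pmod_hom P ?s D s M (\<lambda>a x. h a (e a x))"
    using e h eD by (auto simp: pmod_hom_def linear_between_def)
  then obtain g where g: "pmod_hom P ?s D t X g"
    and fg: "\<And>a x. a \<in> P \<Longrightarrow> x \<in> fib D a \<Longrightarrow> f a (g a x) = h a (e a x)"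
    using cover D unfolding interval_cover_def by blast
  define e' where "e' a = inv_into (fib D a) (e a)" for a
  have e'D: "e' a y \<in> fib D a" and ee': "e a (e' a y) = y" if "a \<in> P" "y \<in> fib Y a" for a y
    using bij[OF that(1)] that(2) unfolding e'_def bij_betw_def
    by (metis inv_into_into, metis f_inv_into_f)
  have e'e: "e' a (e a x) = x" if "a \<in> P" "x \<in> fib D a" for a x
    using bij[OF that(1)] that(2) unfolding e'_def bij_betw_def by simp
  have md: "module ?s"
    using pmD by (simp add: pmodule_def module_def vector_space_def)
  have subD: "module.subspace ?s (fib D a)" if "a \<in> P" for a
    using pmD that by (simp add: pmodule_def)
  have add: "e' a (x + y) = e' a x + e' a y" if "a \<in> P" "x \<in> fib Y a" "y \<in> fib Y a" for a x y
  proof -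
    have "e a (e' a x + e' a y) = x + y"
      using e that e'D ee' by (simp add: pmod_hom_def linear_between_def)
    moreover have "e' a x + e' a y \<in> fib D a"
      using that e'D subD module.subspace_add[OF md] by blast
    ultimately show ?thesis using e'e that(1) by metis
  qed
  have scl: "e' a (r c x) = ?s c (e' a x)" if "a \<in> P" "x \<in> fib Y a" for a c x
  proof -
    have "e a (?s c (e' a x)) = r c x"
      using e that e'D ee' by (simp add: pmod_hom_def linear_between_def)
    moreover have "?s c (e' a x) \<in> fib D a"
      using that e'D subD module.subspace_scale[OF md] by blast
    ultimately show ?thesis using e'e that(1) by metis
  qed
  have nat: "e' b (tr Y a b x) = tr D a b (e' a x)"
    if "a \<in> P" "b \<in> P" "a \<le> b" "x \<in> fib Y a" for a b x
  proof -
    have "e b (tr D a b (e' a x)) = tr Y a b x"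
      using e that e'D ee' by (simp add: pmod_hom_def)
    moreover have "tr D a b (e' a x) \<in> fib D b"
      using pmD that e'D unfolding pmodule_def linear_between_def by blast
    ultimately show ?thesis using e'e that(2) by metis
  qed
  have "pmod_hom P r Y t X (\<lambda>a y. g a (e' a y))"
    using g e'D add scl nat by (auto simp: pmod_hom_def linear_between_def)
  moreover have "\<forall>a\<in>P. \<forall>y\<in>fib Y a. f a (g a (e' a y)) = h a y"
    using fg e'D ee' by simp
  ultimately show ?thesis by blast
qed

end

theory Submission imports Defs begin

text \<open>
  Surjectivity: a vector \<open>x \<in> M\<^sub>a\<close> is the image of \<open>1\<close> under a morphism \<open>k\<^sub>U \<rightarrow> M\<close>, where \<open>U\<close> is
  the interval of all \<open>b \<ge> a\<close>; such a morphism lifts to \<open>X\<close>. Injectivity: the image of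
  \<open>f|X\<^sub>i\<close> is a quotient of an interval module, so it is the sum of the interval modules on the
  connected components of its support. Hence its inclusion into \<open>M\<close> lifts to \<open>X\<close>, and \<open>f|X\<^sub>i\<close>
  equals \<open>f g\<close> for some \<open>g : X\<^sub>i \<rightarrow> X\<close> that kills the kernel of \<open>f|X\<^sub>i\<close>. Replacing the
  restriction of the identity of \<open>X\<close> to \<open>X\<^sub>i\<close> by \<open>g\<close> gives an endomorphism of \<open>X\<close> over \<open>M\<close>,
  which is an isomorphism by right minimality; so this kernel is zero. The equality of supports
  follows, and the images of the \<open>X\<^sub>i\<close> are the required interval submodules.
\<close>

section \<open>Basic facts on modules, morphisms and isomorphisms\<close>

lemma vector_space_imp_module: "vector_space s \<Longrightarrow> module s"
  by (simp add: module_def vector_space_def)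

lemma linear_betweenI:
  assumes "\<And>x. x \<in> V \<Longrightarrow> h x \<in> W"
    and "\<And>x y. x \<in> V \<Longrightarrow> y \<in> V \<Longrightarrow> h (x + y) = h x + h y"
    and "\<And>c x. x \<in> V \<Longrightarrow> h (s c x) = t c (h x)"
  shows "linear_between s V t W h"
  using assms by (simp add: linear_between_def)

lemma pmod_homI:
  assumes "\<And>a. a \<in> P \<Longrightarrow> linear_between s (fib M a) t (fib N a) (g a)"
    and "\<And>a b x. a \<in> P \<Longrightarrow> b \<in> P \<Longrightarrow> a \<le> b \<Longrightarrow> x \<in> fib M a \<Longrightarrow> g b (tr M a b x) = tr N a b (g a x)"
  shows "pmod_hom P s M t N g"
  using assms by (simp add: pmod_hom_def)

lemma pmod_homD:
  assumes "pmod_hom P s M t N g" "a \<in> P"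
  shows pmod_hom_in: "x \<in> fib M a \<Longrightarrow> g a x \<in> fib N a"
    and pmod_hom_add: "x \<in> fib M a \<Longrightarrow> y \<in> fib M a \<Longrightarrow> g a (x + y) = g a x + g a y"
    and pmod_hom_scale: "x \<in> fib M a \<Longrightarrow> g a (s c x) = t c (g a x)"
    and pmod_hom_tr: "b \<in> P \<Longrightarrow> a \<le> b \<Longrightarrow> x \<in> fib M a \<Longrightarrow> g b (tr M a b x) = tr N a b (g a x)"
  using assms by (simp_all add: pmod_hom_def linear_between_def)

lemma pmodule_module: "pmodule P s M \<Longrightarrow> module s"
  by (simp add: pmodule_def vector_space_imp_module)

lemma pmoduleD:
  assumes "pmodule P s M" "a \<in> P"
  shows pmodule_fib_zero: "0 \<in> fib M a"
    and pmodule_fib_add: "x \<in> fib M a \<Longrightarrow> y \<in> fib M a \<Longrightarrow> x + y \<in> fib M a"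
    and pmodule_fib_scale: "x \<in> fib M a \<Longrightarrow> s c x \<in> fib M a"
    and pmodule_tr_in: "b \<in> P \<Longrightarrow> a \<le> b \<Longrightarrow> x \<in> fib M a \<Longrightarrow> tr M a b x \<in> fib M b"
    and pmodule_tr_add: "b \<in> P \<Longrightarrow> a \<le> b \<Longrightarrow> x \<in> fib M a \<Longrightarrow> y \<in> fib M a \<Longrightarrow>
      tr M a b (x + y) = tr M a b x + tr M a b y"
    and pmodule_tr_scale: "b \<in> P \<Longrightarrow> a \<le> b \<Longrightarrow> x \<in> fib M a \<Longrightarrow> tr M a b (s c x) = s c (tr M a b x)"
    and pmodule_tr_id: "x \<in> fib M a \<Longrightarrow> tr M a a x = x"
    and pmodule_tr_comp: "b \<in> P \<Longrightarrow> c' \<in> P \<Longrightarrow> a \<le> b \<Longrightarrow> b \<le> c' \<Longrightarrow> x \<in> fib M a \<Longrightarrow>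
      tr M b c' (tr M a b x) = tr M a c' x"
  using assms module.subspace_def[OF pmodule_module[OF assms(1)]]
  by (auto simp: pmodule_def linear_between_def)

lemma pmodule_tr_zero:
  assumes "pmodule P s M" "a \<in> P" "b \<in> P" "a \<le> b"
  shows "tr M a b 0 = 0"
  using pmodule_tr_add[OF assms pmodule_fib_zero pmodule_fib_zero] assms by simp

lemma pmodule_fib_diff:
  assumes "pmodule P s M" "a \<in> P" "x \<in> fib M a" "y \<in> fib M a"
  shows "x - y \<in> fib M a"
  using assms(2-) module.subspace_diff[OF pmodule_module[OF assms(1)], of "fib M a"] assms(1)
  by (simp add: pmodule_def)

lemma pmod_hom_zero:
  assumes "pmod_hom P s M t N g" "pmodule P s M" "a \<in> P"
  shows "g a 0 = 0"
  using pmod_hom_add[OF assms(1,3), of 0 0] pmodule_fib_zero[OF assms(2,3)] by simp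

lemma linear_between_sum:
  assumes h: "linear_between s V t W h" and s: "module s" and V: "module.subspace s V"
    and x: "\<And>i. i \<in> A \<Longrightarrow> x i \<in> V"
  shows "h (\<Sum>i\<in>A. x i) = (\<Sum>i\<in>A. h (x i))"
proof -
  have "0 \<in> V" "h (0 + 0) = h 0 + h 0"
    using h module.subspace_0[OF s V] unfolding linear_between_def by blast+
  then have h0: "0 \<in> V" "h 0 = 0" by simp_all
  \<comment> \<open>Additivity of \<open>h\<close> is known on \<open>V\<close> only, so the
    induction also carries that the sum stays in \<open>V\<close>. For infinite \<open>A\<close>
    both sums are 0.\<close>
  have "(\<Sum>i\<in>A. x i) \<in> V \<and> ?thesis"
    using x
  proof (induction A rule: infinite_finite_induct)
    case (insert i A)
    then show ?case
      using h module.subspace_add[OF s V] by (simp add: linear_between_def)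
  qed (use h0 in simp_all)
  then show ?thesis ..
qed

lemma pmod_injI:
  assumes "pmod_hom P s M t N g" "pmodule P s M"
    and "\<And>a x. a \<in> P \<Longrightarrow> x \<in> fib M a \<Longrightarrow> g a x = 0 \<Longrightarrow> x = 0"
  shows "pmod_inj P M g"
  unfolding pmod_inj_def
proof (intro ballI inj_onI)
  fix a x y assume *: "a \<in> P" "x \<in> fib M a" "y \<in> fib M a" "g a x = g a y"
  have "g a x = g a (x - y) + g a y"
    using pmod_hom_add[OF assms(1) *(1) pmodule_fib_diff[OF assms(2) *(1-3)] *(3)] by simp
  then have "g a (x - y) = 0"
    using *(4) by simp
  with assms(3) *(1) pmodule_fib_diff[OF assms(2) *(1-3)] have "x - y = 0" by blast
  then show "x = y" by simp
qed

lemma pmod_hom_comp: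
  assumes "pmod_hom P r L s M g" "pmod_hom P s M t N h"
  shows "pmod_hom P r L t N (\<lambda>a x. h a (g a x))"
  using assms by (auto simp: pmod_hom_def linear_between_def)

lemma pmod_iso_comp:
  assumes "pmod_iso P r L s M g" "pmod_iso P s M t N h"
  shows "pmod_iso P r L t N (\<lambda>a x. h a (g a x))"
proof -
  have "inj_on (\<lambda>x. h a (g a x)) (fib L a)" "(\<lambda>x. h a (g a x)) ` fib L a = fib N a"
    if "a \<in> P" for a
    using assms that comp_inj_on[of "g a" "fib L a" "h a"] image_comp[of "h a" "g a" "fib L a"]
    by (auto simp: pmod_iso_def pmod_inj_def pmod_surj_def comp_def)
  then show ?thesis
    using assms pmod_hom_comp by (auto simp: pmod_iso_def pmod_inj_def pmod_surj_def)
qed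

lemma pmod_iso_inverse:
  assumes iso: "pmod_iso P s M t N g" and M: "pmodule P s M"
  obtains g' where "pmod_iso P t N s M g'"
    and "\<And>a y. a \<in> P \<Longrightarrow> y \<in> fib N a \<Longrightarrow> g a (g' a y) = y"
    and "\<And>a x. a \<in> P \<Longrightarrow> x \<in> fib M a \<Longrightarrow> g' a (g a x) = x"
proof -
  have hom: "pmod_hom P s M t N g" and bij: "\<And>a. a \<in> P \<Longrightarrow> bij_betw (g a) (fib M a) (fib N a)"
    using iso by (auto simp: pmod_iso_def pmod_inj_def pmod_surj_def bij_betw_def)
  define g' where "g' a = inv_into (fib M a) (g a)" for a
  have bij': "bij_betw (g' a) (fib N a) (fib M a)" if "a \<in> P" for a
    unfolding g'_def using bij[OF that] by (rule bij_betw_inv_into)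
  have in': "g' a y \<in> fib M a" and gg': "g a (g' a y) = y" if "a \<in> P" "y \<in> fib N a" for a y
    using bij_betwE[OF bij'[OF that(1)]] bij_betw_inv_into_right[OF bij[OF that(1)]] that(2)
    by (simp_all add: g'_def)
  have g'g: "g' a (g a x) = x" if "a \<in> P" "x \<in> fib M a" for a x
    using bij_betw_inv_into_left[OF bij[OF that(1)] that(2)] by (simp add: g'_def)
  have "pmod_hom P t N s M g'"
  proof (intro pmod_homI linear_betweenI)
    fix a x y assume "a \<in> P" "x \<in> fib N a" "y \<in> fib N a"
    then show "g' a (x + y) = g' a x + g' a y"
      using g'g[of a "g' a x + g' a y"] pmod_hom_add[OF hom] pmodule_fib_add[OF M] in' gg' by simp
  next
    fix a c x assume "a \<in> P" "x \<in> fib N a"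
    then show "g' a (t c x) = s c (g' a x)"
      using g'g[of a "s c (g' a x)"] pmod_hom_scale[OF hom] pmodule_fib_scale[OF M] in' gg' by simp
  next
    fix a b x assume "a \<in> P" "b \<in> P" "a \<le> b" "x \<in> fib N a"
    then show "g' b (tr N a b x) = tr M a b (g' a x)"
      using g'g[of b "tr M a b (g' a x)"] pmod_hom_tr[OF hom] pmodule_tr_in[OF M] in' gg' by simp
  qed (use in' in auto)
  then have "pmod_iso P t N s M g'"
    using bij' by (auto simp: pmod_iso_def pmod_inj_def pmod_surj_def bij_betw_def)
  then show thesis
    using that gg' g'g by blast
qed

text \<open>Every vector in a fibre of \<open>N\<close> is an image, so each module axiom is
  inherited from \<open>X\<close>. This yields the module axioms both for isomorphic copies and for
  the images of the summands in \<open>M\<close>.\<close>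

lemma pmodule_surj_image:
  assumes X: "pmodule P s X" and t: "vector_space t"
    and g: "pmod_hom P s X t N g" and surj: "pmod_surj P X N g"
  shows "pmodule P t N"
proof -
  interpret X: vector_space s using X by (simp add: pmodule_def)
  interpret N: vector_space t by fact
  have im: "fib N a = g a ` fib X a" if "a \<in> P" for a
    using surj that by (simp add: pmod_surj_def)
  note X_simps = pmoduleD[OF X]
  note g_simps = pmod_homD(2-4)[OF g, symmetric]
  have "N.subspace (fib N a)" if "a \<in> P" for a
    unfolding N.subspace_def using that X_simps g_simps pmod_hom_zero[OF g X]
    by (auto simp: im intro!: image_eqI[of _ _ 0] intro: image_eqI)
  moreover have "\<exists>B. finite B \<and> fib N a \<subseteq> N.span B" if a: "a \<in> P" for a
  proof -
    \<comment> \<open>The finite spanning set in \<open>pmodule\<close> may lie outside the fibre,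
      where \<open>g a\<close> is not known to be linear. A basis inside the fibre has a usable
      image; it is finite because an independent set is no larger than a finite set spanning
      it.\<close>
    obtain B where B: "B \<subseteq> fib X a" "X.independent B" "fib X a \<subseteq> X.span B"
      using X.basis_exists by metis
    have "finite B"
    proof -
      have "\<exists>E. finite E \<and> fib X a \<subseteq> X.span E"
        using X a by (simp add: pmodule_def)
      then obtain E where "finite E" "fib X a \<subseteq> X.span E" by blast
      then show ?thesis
        using X.independent_span_bound[OF _ B(2) subset_trans[OF B(1)], of E] by simp
    qed
    have "g a x \<in> N.span (g a ` B)" if "x \<in> X.span B" for x
    proof -
      have "x \<in> fib X a \<and> g a x \<in> N.span (g a ` B)"
        using that
      proof (induction rule: X.span_induct_alt)
        case base
        then show ?case using pmod_hom_zero[OF g X a] X_simps(1)[OF a] N.span_zero by simp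
      next
        case (step c x y)
        then have "x \<in> fib X a" "g a x \<in> N.span (g a ` B)"
          using B(1) by (auto intro: N.span_base)
        then show ?case
          using step a X_simps(2,3)[OF a] pmod_homD(2,3)[OF g a] N.span_add N.span_scale by simp
      qed
      then show ?thesis ..
    qed
    then show ?thesis
      using B(3) \<open>finite B\<close> a by (intro exI[of _ "g a ` B"]) (auto simp: im)
  qed
  moreover have "linear_between t (fib N a) t (fib N b) (tr N a b)"
    if "a \<in> P" "b \<in> P" "a \<le> b" for a b
    using that X_simps by (intro linear_betweenI) (auto simp: im g_simps)
  ultimately show ?thesis
    unfolding pmodule_def using t X_simps by (auto simp: im g_simps)
qed

section \<open>Transport of decomposability and covers along isomorphisms\<close>

lemma interval_decomposable_iso:
  assumes X: "interval_decomposable P s X" and t: "vector_space t" and iso: "pmod_iso P s X t N g"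
  shows "interval_decomposable P t N"
proof -
  have "pmodule P t N"
    using X t iso pmodule_surj_image by (auto simp: interval_decomposable_def pmod_iso_def)
  then show ?thesis
    using X pmod_iso_comp[OF _ iso] unfolding interval_decomposable_def by blast
qed

text \<open>Both cover conditions move along \<open>q\<close>: a lift to \<open>X\<close> is
  composed with \<open>q\<close>, and an endomorphism of \<open>Z\<close> over \<open>M\<close> is
  conjugated to one of \<open>X\<close> over \<open>M\<close>. In the end this replaces the summands
  of a cover by their images in \<open>M\<close>.\<close>

lemma interval_cover_iso:
  fixes t :: "'k::field \<Rightarrow> 'w::ab_group_add \<Rightarrow> 'w" and u :: "'k \<Rightarrow> 'u::ab_group_add \<Rightarrow> 'u"
  assumes cover: "interval_cover P t X s M f" and u: "vector_space u"
    and iso: "pmod_iso P t X u Z q" and f': "pmod_hom P u Z s M f'"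
    and f'q: "\<And>a x. a \<in> P \<Longrightarrow> x \<in> fib X a \<Longrightarrow> f' a (q a x) = f a x"
  shows "interval_cover P u Z s M f'"
proof -
  have X: "interval_decomposable P t X" "pmodule P t X" and M: "pmodule P s M"
    using cover by (simp_all add: interval_cover_def interval_decomposable_def)
  have Z: "interval_decomposable P u Z"
    using X(1) u iso by (rule interval_decomposable_iso)
  obtain q' where iso': "pmod_iso P u Z t X q'"
    and qq': "\<And>a z. a \<in> P \<Longrightarrow> z \<in> fib Z a \<Longrightarrow> q a (q' a z) = z"
    and q'q: "\<And>a x. a \<in> P \<Longrightarrow> x \<in> fib X a \<Longrightarrow> q' a (q a x) = x"
    using pmod_iso_inverse[OF iso X(2)] by blast
  have q: "pmod_hom P t X u Z q" and q': "pmod_hom P u Z t X q'"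
    using iso iso' by (simp_all add: pmod_iso_def)
  have fq': "f a (q' a z) = f' a z" if "a \<in> P" "z \<in> fib Z a" for a z
    using that f'q[of a "q' a z"] qq' pmod_hom_in[OF q'] by simp
  have "\<exists>g. pmod_hom P r Y u Z g \<and> (\<forall>a\<in>P. \<forall>y\<in>fib Y a. f' a (g a y) = h a y)"
    if Y: "interval_decomposable P r Y" and h: "pmod_hom P r Y s M h"
    for r :: "'k \<Rightarrow> (nat \<Rightarrow> 'k) \<Rightarrow> (nat \<Rightarrow> 'k)" and Y h
  proof -
    obtain g where g: "pmod_hom P r Y t X g" "\<forall>a\<in>P. \<forall>y\<in>fib Y a. f a (g a y) = h a y"
      using interval_cover_lift[OF cover Y h] by blast
    then show ?thesis
      using pmod_hom_comp[OF g(1) q] f'q pmod_hom_in[OF g(1)]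
      by (intro exI[of _ "\<lambda>a y. q a (g a y)"]) auto
  qed
  moreover have "pmod_iso P u Z u Z g"
    if g: "pmod_hom P u Z u Z g" and f'g: "\<forall>a\<in>P. \<forall>z\<in>fib Z a. f' a (g a z) = f' a z" for g
  proof -
    let ?h = "\<lambda>a x. q' a (g a (q a x))"
    have "pmod_hom P t X t X ?h"
      using pmod_hom_comp[OF pmod_hom_comp[OF q g] q'] .
    moreover have "\<forall>a\<in>P. \<forall>x\<in>fib X a. f a (?h a x) = f a x"
      using fq' f'g f'q pmod_hom_in[OF q] pmod_hom_in[OF g] by simp
    ultimately have "pmod_iso P t X t X ?h"
      using cover by (simp add: interval_cover_def)
    then have "pmod_iso P u Z u Z (\<lambda>a z. q a (?h a (q' a z)))"
      using pmod_iso_comp[OF iso' pmod_iso_comp[OF _ iso]] by blast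
    \<comment> \<open>Conjugating back gives \<open>g\<close> on the fibres only, which is all that
      injectivity and surjectivity see.\<close>
    moreover have "q a (?h a (q' a z)) = g a z" if "a \<in> P" "z \<in> fib Z a" for a z
      using that qq' pmod_hom_in[OF g] by simp
    ultimately show ?thesis
      using g by (simp add: pmod_iso_def pmod_inj_def pmod_surj_def cong: inj_on_cong image_cong)
  qed
  ultimately show ?thesis
    using M Z f' by (simp add: interval_cover_def)
qed

text \<open>Coordinate 0 identifies the direct sum with one term with that term. The module axioms
  of \<open>kmod I\<close> come along this surjection from those already known for direct
  sums.\<close>

lemma interval_decomposable_kmod:
  fixes I :: "'p::order set"
  assumes "interval P I"
  shows "interval_decomposable P (*) (kmod I :: ('p, 'k::field) pmod)"
proof -
  let ?s = "scale_seq ((*) :: 'k \<Rightarrow> 'k \<Rightarrow> 'k)"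
  let ?D = "direct_sum 1 (\<lambda>_. kmod I) :: ('p, nat \<Rightarrow> 'k) pmod"
  have "pmod_hom P ?s ?D (*) (kmod I :: ('p, 'k) pmod) (\<lambda>a x. x 0)"
    by (auto simp: pmod_hom_def linear_between_def direct_sum_def kmod_def scale_seq_def
        split: if_splits)
  moreover have "pmod_inj P ?D (\<lambda>a x. x 0)"
    unfolding pmod_inj_def
  proof (intro ballI inj_onI ext)
    fix a x y and i :: nat
    assume "x \<in> fib ?D a" "y \<in> fib ?D a" "x 0 = y 0"
    then show "x i = y i" by (cases i) (simp_all add: direct_sum_def)
  qed
  moreover have "pmod_surj P ?D (kmod I :: ('p, 'k) pmod) (\<lambda>a x. x 0)"
    unfolding pmod_surj_def
  proof (intro ballI equalityI subsetI)
    fix a x assume "x \<in> fib (kmod I :: ('p, 'k) pmod) a"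
    then show "x \<in> (\<lambda>x. x 0) ` fib ?D a"
      by (intro image_eqI[of _ _ "summand_incl 0 x"]) (auto simp: summand_incl_def direct_sum_def)
  qed (auto simp: direct_sum_def)
  ultimately have iso: "pmod_iso P ?s ?D (*) (kmod I :: ('p, 'k) pmod) (\<lambda>a x. x 0)"
    by (simp add: pmod_iso_def)
  moreover have "pmodule P (*) (kmod I :: ('p, 'k) pmod)"
    using pmodule_surj_image[OF pmodule_direct_sum_kmod[of 1 P "\<lambda>_. I"] vector_space_mult] assms iso
    by (auto simp: pmod_iso_def)
  ultimately show ?thesis
    unfolding interval_decomposable_def using assms
    by (intro conjI exI[of _ "1::nat"] exI[of _ "\<lambda>_. I"] exI[of _ "\<lambda>a x. x 0"]) auto
qed

lemma pmodule_kmod: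
  "interval P I \<Longrightarrow> pmodule P (*) (kmod I :: ('p::order, 'k::field) pmod)"
  using interval_decomposable_kmod unfolding interval_decomposable_def by blast

section \<open>Connected components of subsets of a poset\<close>

definition comparability :: "'p::order set \<Rightarrow> ('p \<times> 'p) set" where
  "comparability J = {(u, v). u \<in> J \<and> v \<in> J \<and> (u \<le> v \<or> v \<le> u)}"

text \<open>The closure is reflexive, so for \<open>a\<close> outside \<open>J\<close> this is
  \<open>{a}\<close>; hence the assumption \<open>a \<in> J\<close> in the facts that place the
  component inside \<open>J\<close>.\<close>

definition component :: "'p::order set \<Rightarrow> 'p \<Rightarrow> 'p set" where
  "component J a = {b. (a, b) \<in> (comparability J)\<^sup>*}"

lemma sym_comparability: "sym (comparability J)"
  by (auto simp: comparability_def sym_def)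

lemma component_refl: "a \<in> component J a"
  by (simp add: component_def)

lemma component_step: "b \<in> component J a \<Longrightarrow> (b, c) \<in> comparability J \<Longrightarrow> c \<in> component J a"
  by (simp add: component_def rtrancl_into_rtrancl[of a b])

lemma component_subset:
  assumes "a \<in> J"
  shows "component J a \<subseteq> J"
proof
  fix b assume "b \<in> component J a"
  then have "(a, b) \<in> (comparability J)\<^sup>*"
    by (simp add: component_def)
  then show "b \<in> J"
    by (induction) (use assms in \<open>auto simp: comparability_def\<close>)
qed

lemma component_eq:
  assumes "a \<in> J" "b \<in> J" "a \<le> b"
  shows "component J a = component J b"
proof -
  have ab: "(a, b) \<in> comparability J" "(b, a) \<in> comparability J"
    using assms by (auto simp: comparability_def)
  show ?thesis
    unfolding component_def using ab[THEN converse_rtrancl_into_rtrancl] by blast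
qed

text \<open>A comparability path in \<open>J\<close> from \<open>a\<close> visits only points of the
  component, so it is a path inside the component too. Convexity of \<open>J\<close> puts a point
  between two points of the component into \<open>J\<close>, and it is comparable to them.\<close>

lemma interval_component:
  assumes "J \<subseteq> P" "a \<in> J"
    and conv: "\<And>x y z. x \<in> J \<Longrightarrow> y \<in> J \<Longrightarrow> z \<in> P \<Longrightarrow> x < z \<Longrightarrow> z < y \<Longrightarrow> z \<in> J"
  shows "interval P (component J a)"
proof -
  let ?C = "component J a"
  have CJ: "?C \<subseteq> J" using assms(2) by (rule component_subset)
  have from_a: "(a, b) \<in> (comparability ?C)\<^sup>*" if "b \<in> ?C" for b
  proof -
    have "(a, b) \<in> (comparability J)\<^sup>*" using that by (simp add: component_def)
    then show ?thesis
    proof (induction)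
      case (step y z)
      then have "y \<in> ?C" "z \<in> ?C"
        using rtrancl_into_rtrancl[OF step.hyps(1,2)] by (simp_all add: component_def)
      then have "(y, z) \<in> comparability ?C"
        using step.hyps(2) by (auto simp: comparability_def)
      with step.IH show ?case by (rule rtrancl_into_rtrancl)
    qed simp
  qed
  have "(x, y) \<in> (comparability ?C)\<^sup>*" if "x \<in> ?C" "y \<in> ?C" for x y
    using symD[OF sym_rtrancl[OF sym_comparability] from_a[OF that(1)]] from_a[OF that(2)]
    by (rule rtrancl_trans)
  then have conn: "poset_connected ?C"
    by (simp add: poset_connected_def comparability_def)
  have conv': "z \<in> ?C" if "x \<in> ?C" "y \<in> ?C" "z \<in> P" "x < z" "z < y" for x y z
  proof -
    have "x \<in> J" "y \<in> J" using that CJ by blast+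
    then have "z \<in> J" using that(3-5) by (rule conv)
    with \<open>x \<in> J\<close> have "(x, z) \<in> comparability J"
      using that by (simp add: comparability_def less_imp_le)
    with that(1) show ?thesis by (rule component_step)
  qed
  show ?thesis
    unfolding interval_def
  proof (intro conjI ballI impI)
    show "?C \<noteq> {}" using component_refl[of a J] by blast
    show "?C \<subseteq> P" using CJ assms(1) by (rule subset_trans)
    show "z \<in> ?C" if "x \<in> ?C" "y \<in> ?C" "z \<in> P" "x < z \<and> z < y" for x y z
      using that conv' by blast
  qed (fact conn)
qed

section \<open>Lifts of morphisms from an interval module that vanish on the kernel\<close>

lemma interval_convex:
  "interval P I \<Longrightarrow> x \<in> I \<Longrightarrow> y \<in> I \<Longrightarrow> z \<in> P \<Longrightarrow> x < z \<Longrightarrow> z < y \<Longrightarrow> z \<in> I"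
  unfolding interval_def by blast

text \<open>An arbitrary lift of \<open>h\<close> need not vanish where \<open>h\<close> does. The
  lift is therefore made on the image of \<open>h\<close>, one component of its support at a time,
  and extended by zero to \<open>I\<close>.\<close>

lemma interval_cover_lift_kernel:
  fixes P :: "'p::order set" and t :: "'k::field \<Rightarrow> 'w::ab_group_add \<Rightarrow> 'w"
    and h :: "'p \<Rightarrow> 'k \<Rightarrow> 'v::ab_group_add"
  assumes cover: "interval_cover P t X s M f" and I: "interval P I"
    and h: "pmod_hom P (*) (kmod I) s M h"
  obtains g where "pmod_hom P (*) (kmod I) t X g"
    and "\<And>a x. a \<in> P \<Longrightarrow> x \<in> fib (kmod I) a \<Longrightarrow> f a (g a x) = h a x"
    and "\<And>a x. a \<in> P \<Longrightarrow> x \<in> fib (kmod I) a \<Longrightarrow> h a x = 0 \<Longrightarrow> g a x = 0"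
proof -
  \<comment> \<open>By linearity \<open>h a\<close> is determined by \<open>h a 1\<close>, so
    \<open>J\<close> is the support of the image of \<open>h\<close>, and \<open>h a\<close> is
    injective for \<open>a\<close> in \<open>J\<close>.\<close>
  define J where "J = {a \<in> I. h a 1 \<noteq> 0}"
  have X: "pmodule P t X" and M: "pmodule P s M" and f: "pmod_hom P t X s M f"
    using cover by (simp_all add: interval_cover_def interval_decomposable_def)
  interpret M: vector_space s using M by (simp add: pmodule_def)
  have IP: "I \<subseteq> P" and JI: "J \<subseteq> I"
    using I by (auto simp: interval_def J_def)
  then have JP: "J \<subseteq> P" by blast
  have kI: "pmodule P (*) (kmod I :: ('p, 'k) pmod)"
    using I by (rule pmodule_kmod)
  have h_scale: "h a x = s x (h a 1)" if "a \<in> I" for a x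
    using pmod_hom_scale[OF h, of a 1 x] that IP by (auto simp: kmod_def)
  have h_tr: "tr M a b (h a x) = h b (if b \<in> I then x else 0)" if "a \<in> I" "b \<in> P" "a \<le> b" for a b x
    using pmod_hom_tr[OF h, of a b x] that IP by (auto simp: kmod_def)
  have h0: "h a 0 = 0" if "a \<in> P" for a
    using pmod_hom_zero[OF h kI that] .
  \<comment> \<open>The transition from \<open>a\<close> to \<open>b\<close> sends
    \<open>h a 1\<close> to \<open>h b 1\<close>, so a nonzero value at \<open>b\<close> forces one
    at \<open>a\<close>. Convexity of \<open>J\<close> follows from this and convexity of
    \<open>I\<close>.\<close>
  have J_down: "a \<in> J" if "a \<in> I" "b \<in> J" "a \<le> b" for a b
  proof -
    have "a \<in> P" "b \<in> P" "b \<in> I" using that JI IP by blast+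
    then show ?thesis
      using h_tr[of a b 1] that pmodule_tr_zero[OF M, of a b] by (auto simp: J_def)
  qed
  have J_conv: "z \<in> J" if "x \<in> J" "y \<in> J" "z \<in> P" "x < z" "z < y" for x y z
  proof -
    have "x \<in> I" "y \<in> I" using that(1,2) JI by blast+
    then have "z \<in> I" using that(3-5) by (rule interval_convex[OF I])
    then show ?thesis using that(2) less_imp_le[OF that(5)] by (rule J_down)
  qed
  have lift: "\<exists>g. pmod_hom P (*) (kmod (component J c)) t X g \<and>
      (\<forall>a\<in>component J c. \<forall>x. f a (g a x) = h a x)" if c: "c \<in> J" for c
  proof -
    let ?C = "component J c"
    have CJ: "?C \<subseteq> J"
      using c by (rule component_subset)
    have C: "interval P ?C"
      using JP c J_conv by (rule interval_component)
    have up: "b \<in> ?C" if "a \<in> ?C" "b \<in> J" "a \<le> b" for a b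
      using that CJ by (intro component_step[OF that(1)]) (auto simp: comparability_def)
    have "pmod_hom P (*) (kmod ?C) s M (\<lambda>a x. if a \<in> ?C then h a x else 0)"
    proof (intro pmod_homI linear_betweenI)
      fix a b and x :: 'k
      assume ab: "a \<in> P" "b \<in> P" "a \<le> b" and x: "x \<in> fib (kmod ?C) a"
      show "(if b \<in> ?C then h b (tr (kmod ?C) a b x) else 0) = tr M a b (if a \<in> ?C then h a x else 0)"
      proof (cases "a \<in> ?C")
        case True
        \<comment> \<open>A point of \<open>I\<close> above the component but outside it cannot lie
          in \<open>J\<close>. So \<open>h\<close> vanishes there, and cutting \<open>h\<close> off
          outside the component keeps it natural.\<close>
        have "h b x = 0" if "b \<in> I" "b \<notin> ?C"
          using that True ab up[of a b] h_scale[of b x] by (auto simp: J_def)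
        moreover have "a \<in> I" "b \<in> ?C \<Longrightarrow> b \<in> I"
          using True CJ JI by blast+
        ultimately show ?thesis
          using True ab h_tr[of a b x] h0 by (auto simp: kmod_def)
      next
        case False
        then show ?thesis
          using ab x h0 pmodule_tr_zero[OF M ab] by (auto simp: kmod_def)
      qed
    qed (use CJ JI pmodule_fib_zero[OF M] pmod_homD(1-3)[OF h] in \<open>auto simp: kmod_def subset_iff\<close>)
    from interval_cover_lift[OF cover interval_decomposable_kmod[OF C] this]
    show ?thesis
      using CJ JI IP by (fastforce simp: kmod_def)
  qed
  \<comment> \<open>The chosen lifts are indexed by components rather than by points, so that points
    of the same component use the same lift.\<close>
  have "\<exists>G. \<forall>c\<in>J. pmod_hom P (*) (kmod (component J c)) t X (G (component J c)) \<and>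
      (\<forall>a\<in>component J c. \<forall>x. f a (G (component J c) a x) = h a x)"
  proof -
    have "\<forall>C\<in>component J ` J. \<exists>g. pmod_hom P (*) (kmod C) t X g \<and>
      (\<forall>a\<in>C. \<forall>x. f a (g a x) = h a x)"
      using lift by blast
    from bchoice[OF this] show ?thesis by auto
  qed
  then obtain G where G: "\<And>c. c \<in> J \<Longrightarrow> pmod_hom P (*) (kmod (component J c)) t X (G (component J c))"
    and fG: "\<And>c x. c \<in> J \<Longrightarrow> f c (G (component J c) c x) = h c x"
    using component_refl by metis
  \<comment> \<open>Gluing needs no choice of representatives: comparable points of \<open>J\<close> share their component,
    and \<open>J\<close> is downward closed in \<open>I\<close>.\<close>
  define g where "g a x = (if a \<in> J then G (component J a) a x else 0)" for a x
  have "pmod_hom P (*) (kmod I) t X g"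
  proof (intro pmod_homI linear_betweenI)
    fix a b and x :: 'k assume ab: "a \<in> P" "b \<in> P" "a \<le> b" and x: "x \<in> fib (kmod I) a"
    show "g b (tr (kmod I) a b x) = tr X a b (g a x)"
    proof (cases "a \<in> J")
      case True
      have eq: "G (component J a) b (if b \<in> component J a then x else 0) = tr X a b (g a x)"
        using pmod_hom_tr[OF G[OF True] ab, of x] True component_refl[of a J]
        by (auto simp: g_def kmod_def)
      show ?thesis
      proof (cases "b \<in> J")
        case bJ: True
        then show ?thesis
          using eq True component_eq[OF True bJ ab(3)] component_refl[of b J] JI
          by (auto simp: g_def kmod_def)
      next
        case False
        \<comment> \<open>Here \<open>b\<close> has left the component, whose module has fibre
          \<open>{0}\<close> at \<open>b\<close>. Naturality of the lift then shows that the
          transition of \<open>X\<close> kills \<open>g a x\<close>.\<close>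
        have kC: "pmodule P (*) (kmod (component J a) :: ('p, 'k) pmod)"
          using interval_component[OF JP True J_conv] by (rule pmodule_kmod)
        have "b \<notin> component J a"
          using False component_subset[OF True] by blast
        then show ?thesis
          using False True eq pmod_hom_zero[OF G[OF True] kC ab(2)]
          by (auto simp: g_def)
      qed
    next
      case False
      \<comment> \<open>Either \<open>a\<close> is outside \<open>I\<close> and the transition of
        \<open>kmod I\<close> is zero, or \<open>J_down\<close> keeps \<open>b\<close> out of
        \<open>J\<close> as well.\<close>
      then have "tr (kmod I) a b x = 0 \<or> b \<notin> J"
        using J_down ab by (auto simp: kmod_def)
      moreover have "g b 0 = 0"
      proof (cases "b \<in> J")
        case True
        then show ?thesis
          using pmod_hom_add[OF G[OF True] ab(2), of 0 0] by (auto simp: g_def kmod_def)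
      qed (simp add: g_def)
      ultimately show ?thesis
        using False pmodule_tr_zero[OF X ab] by (auto simp: g_def)
    qed
  next
    fix a and x :: 'k assume a: "a \<in> P"
    show "g a x \<in> fib X a"
      using a pmod_hom_in[OF G a, of a x] component_refl[of a J] pmodule_fib_zero[OF X a]
      by (auto simp: g_def kmod_def)
  next
    fix a and x y :: 'k assume a: "a \<in> P"
    show "g a (x + y) = g a x + g a y"
      using a pmod_hom_add[OF G a, of a x y] component_refl[of a J]
      by (auto simp: g_def kmod_def)
  next
    fix a and c x :: 'k assume a: "a \<in> P"
    have "module t" using X by (rule pmodule_module)
    then show "g a (c * x) = t c (g a x)"
      using a pmod_hom_scale[OF G a, of a x c] component_refl[of a J] module.scale_zero_right
      by (auto simp: g_def kmod_def)
  qed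
  moreover have "f a (g a x) = h a x" if "a \<in> P" "x \<in> fib (kmod I) a" for a x
  proof -
    have "h a x = 0" if "a \<notin> J"
      using that \<open>x \<in> fib (kmod I) a\<close> h_scale[of a x] h0[OF \<open>a \<in> P\<close>]
      by (cases "a \<in> I") (auto simp: J_def kmod_def)
    then show ?thesis
      using fG pmod_hom_zero[OF f X \<open>a \<in> P\<close>] by (auto simp: g_def)
  qed
  \<comment> \<open>On \<open>J\<close> the vector \<open>h a x\<close> is the multiple by
    \<open>x\<close> of a nonzero vector, so its vanishing means \<open>x = 0\<close>; elsewhere
    \<open>g\<close> is zero by definition.\<close>
  moreover have "g a x = 0" if "a \<in> P" "x \<in> fib (kmod I) a" "h a x = 0" for a x
  proof (cases "a \<in> J")
    case True
    then have "x = 0"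
      using that h_scale[of a x] JI by (auto simp: J_def)
    then show ?thesis
      using True that(1) pmod_hom_add[OF G[OF True] that(1), of 0 0] by (auto simp: g_def kmod_def)
  qed (simp add: g_def)
  ultimately show thesis using that by blast
qed

section \<open>Surjectivity of the cover\<close>

lemma interval_principal_upset:
  assumes "a \<in> P"
  shows "interval P {b \<in> P. a \<le> b}"
proof -
  let ?U = "{b \<in> P. a \<le> b}"
  have "(x, y) \<in> {(u, v). u \<in> ?U \<and> v \<in> ?U \<and> (u \<le> v \<or> v \<le> u)}\<^sup>*" if "x \<in> ?U" "y \<in> ?U" for x y
    using that assms by (intro converse_rtrancl_into_rtrancl[of x a] r_into_rtrancl) auto
  then show ?thesis
    using assms by (auto simp: interval_def poset_connected_def)
qed

lemma interval_cover_surj: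
  fixes P :: "'p::order set" and t :: "'k::field \<Rightarrow> 'w::ab_group_add \<Rightarrow> 'w"
  assumes cover: "interval_cover P t X s M f"
  shows "pmod_surj P X M f"
  unfolding pmod_surj_def
proof (intro ballI equalityI subsetI)
  fix a x assume a: "a \<in> P" and x: "x \<in> fib M a"
  define U where "U = {b \<in> P. a \<le> b}"
  have M: "pmodule P s M" using cover by (simp add: interval_cover_def)
  interpret M: vector_space s using M by (simp add: pmodule_def)
  have U: "interval P U" using interval_principal_upset[OF a] by (simp add: U_def)
  \<comment> \<open>This is the Yoneda morphism of \<open>x\<close>. Outside \<open>U\<close> the
    fibre is \<open>{0}\<close>, so the unspecified value of \<open>tr M a b x\<close> is only ever
    multiplied by 0.\<close>
  have "pmod_hom P (*) (kmod U) s M (\<lambda>b c. s c (tr M a b x))"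
  proof (intro pmod_homI linear_betweenI)
    fix b c and k :: 'k assume "b \<in> P" "c \<in> P" "b \<le> c" "k \<in> fib (kmod U) b"
    then show "s (tr (kmod U) b c k) (tr M a c x) = tr M b c (s k (tr M a b x))"
      using a x pmodule_tr_in[OF M] pmodule_tr_scale[OF M] pmodule_tr_comp[OF M] pmodule_tr_zero[OF M]
      by (auto simp: kmod_def U_def split: if_splits)
  next
    fix b and k :: 'k assume "b \<in> P" "k \<in> fib (kmod U) b"
    then show "s k (tr M a b x) \<in> fib M b"
      using a x pmodule_tr_in[OF M] pmodule_fib_scale[OF M] pmodule_fib_zero[OF M]
      by (auto simp: kmod_def U_def split: if_splits)
  qed (simp_all add: M.scale_left_distrib)
  from interval_cover_lift[OF cover interval_decomposable_kmod[OF U] this]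
  obtain g where g: "pmod_hom P (*) (kmod U) t X g"
    "\<And>b c. b \<in> P \<Longrightarrow> c \<in> fib (kmod U) b \<Longrightarrow> f b (g b c) = s c (tr M a b x)"
    by blast
  have "1 \<in> fib (kmod U :: ('p, 'k) pmod) a"
    using a by (simp add: kmod_def U_def)
  then have "f a (g a 1) = x" "g a 1 \<in> fib X a"
    using g(2)[OF a, of 1] pmodule_tr_id[OF M a x] pmod_hom_in[OF g(1) a] by simp_all
  then show "x \<in> f a ` fib X a" by blast
next
  fix a y assume "a \<in> P" "y \<in> f a ` fib X a"
  then show "y \<in> fib M a"
    using cover pmod_hom_in by (fastforce simp: interval_cover_def)
qed

section \<open>Direct sums and injectivity on each summand\<close>

lemma summand_incl_hom:
  assumes "i < m" and X: "\<And>i. i < m \<Longrightarrow> pmodule P t (X i)"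
  shows "pmod_hom P t (X i) (scale_seq t) (direct_sum m X) (\<lambda>a. summand_incl i)"
proof -
  have "module t" using X[OF assms(1)] by (rule pmodule_module)
  then show ?thesis
    using assms(1) pmodule_fib_zero[OF X] pmodule_tr_zero[OF X]
    by (intro pmod_homI linear_betweenI)
      (auto simp: summand_incl_def direct_sum_def scale_seq_def fun_eq_iff module.scale_zero_right)
qed

lemma direct_sum_decomp:
  assumes "x \<in> fib (direct_sum m X) a"
  shows "x = (\<Sum>i<m. summand_incl i (x i))"
proof
  fix j
  have "(\<Sum>i<m. summand_incl i (x i)) j = (\<Sum>i<m. summand_incl i (x i) j)"
    by (induction m) simp_all
  also have "\<dots> = (\<Sum>i<m. if i = j then x i else 0)"
    by (rule sum.cong) (auto simp: summand_incl_def)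
  also have "\<dots> = x j"
    using assms by (auto simp: direct_sum_def)
  finally show "x j = (\<Sum>i<m. summand_incl i (x i)) j" by simp
qed

text \<open>This endomorphism is the identity on every summand except the \<open>i\<close>-th, where
  it is \<open>g\<close>. It is the one to which right minimality will be applied.\<close>

lemma direct_sum_replace_summand_hom:
  assumes X: "\<And>i. i < m \<Longrightarrow> pmodule P t (X i)"
    and g: "pmod_hom P t (X i) (scale_seq t) (direct_sum m X) g"
    and D: "pmodule P (scale_seq t) (direct_sum m X)" and i: "i < m"
  shows "pmod_hom P (scale_seq t) (direct_sum m X) (scale_seq t) (direct_sum m X)
    (\<lambda>a x. x(i := 0) + g a (x i))"
proof -
  have t: "module t" using X[OF i] by (rule pmodule_module)
  have xi: "x i \<in> fib (X i) a" if "x \<in> fib (direct_sum m X) a" for a x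
    using that i by (auto simp: direct_sum_def)
  have x0: "x(i := 0) \<in> fib (direct_sum m X) a" if "x \<in> fib (direct_sum m X) a" "a \<in> P" for a x
    using that i pmodule_fib_zero[OF X] by (auto simp: direct_sum_def)
  show ?thesis
  proof (intro pmod_homI linear_betweenI)
    fix a x assume "a \<in> P" "x \<in> fib (direct_sum m X) a"
    then show "x(i := 0) + g a (x i) \<in> fib (direct_sum m X) a"
      using pmodule_fib_add[OF D] x0 xi pmod_hom_in[OF g] by simp
  next
    fix a x y assume "a \<in> P" "x \<in> fib (direct_sum m X) a" "y \<in> fib (direct_sum m X) a"
    then show "(x + y)(i := 0) + g a ((x + y) i) = x(i := 0) + g a (x i) + (y(i := 0) + g a (y i))"
      using pmod_hom_add[OF g] xi by (auto simp: fun_eq_iff)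
  next
    fix a c x assume "a \<in> P" "x \<in> fib (direct_sum m X) a"
    then show "(scale_seq t c x)(i := 0) + g a (scale_seq t c x i) = scale_seq t c (x(i := 0) + g a (x i))"
      using pmod_hom_scale[OF g] xi
      by (auto simp: fun_eq_iff scale_seq_def module.scale_right_distrib[OF t]
          module.scale_zero_right[OF t])
  next
    fix a b x assume ab: "a \<in> P" "b \<in> P" "a \<le> b" and x: "x \<in> fib (direct_sum m X) a"
    have "tr (direct_sum m X) a b (x(i := 0)) = (tr (direct_sum m X) a b x)(i := 0)"
      using pmodule_tr_zero[OF X[OF i] ab] by (auto simp: direct_sum_def fun_eq_iff)
    moreover have "tr (direct_sum m X) a b x i = tr (X i) a b (x i)"
      using i by (simp add: direct_sum_def)
    ultimately show "(tr (direct_sum m X) a b x)(i := 0) + g b (tr (direct_sum m X) a b x i) =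
        tr (direct_sum m X) a b (x(i := 0) + g a (x i))"
      using pmod_hom_tr[OF g ab xi[OF x]]
        pmodule_tr_add[OF D ab x0[OF x ab(1)] pmod_hom_in[OF g ab(1) xi[OF x]]]
      by simp
  qed
qed

lemma interval_cover_summand_inj:
  fixes P :: "'p::order set" and t :: "'k::field \<Rightarrow> 'w::ab_group_add \<Rightarrow> 'w"
  assumes cover: "interval_cover P (scale_seq t) (direct_sum m X) s M f"
    and X: "\<And>i. i < m \<Longrightarrow> interval_module P t (X i)" and i: "i < m"
  shows "pmod_inj P (X i) (\<lambda>a x. f a (summand_incl i x))"
proof -
  let ?D = "direct_sum m X"
  have pX: "\<And>i. i < m \<Longrightarrow> pmodule P t (X i)"
    using X by (simp add: interval_module_def)
  have D: "pmodule P (scale_seq t) ?D" and f: "pmod_hom P (scale_seq t) ?D s M f"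
    using cover by (simp_all add: interval_cover_def interval_decomposable_def)
  have incl: "pmod_hom P t (X i) (scale_seq t) ?D (\<lambda>a. summand_incl i)"
    using i pX by (rule summand_incl_hom)
  have fi: "pmod_hom P t (X i) s M (\<lambda>a x. f a (summand_incl i x))"
    using pmod_hom_comp[OF incl f] .
  obtain I e where I: "interval P I" and e: "pmod_iso P (*) (kmod I :: ('p, 'k) pmod) t (X i) e"
    using X[OF i] unfolding interval_module_def by blast
  have kI: "pmodule P (*) (kmod I :: ('p, 'k) pmod)"
    using I by (rule pmodule_kmod)
  obtain e' where e': "pmod_iso P t (X i) (*) (kmod I) e'"
    and ee': "\<And>a x. a \<in> P \<Longrightarrow> x \<in> fib (X i) a \<Longrightarrow> e a (e' a x) = x"
    by (rule pmod_iso_inverse[OF e kI]) (rule that)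
  have he: "pmod_hom P (*) (kmod I) t (X i) e" and he': "pmod_hom P t (X i) (*) (kmod I) e'"
    using e e' by (simp_all add: pmod_iso_def)
  \<comment> \<open>Read on \<open>kmod I\<close>, the restriction of \<open>f\<close> to the
    summand starts from an interval module, so it has a lift vanishing on its kernel.\<close>
  obtain g0 where g0: "pmod_hom P (*) (kmod I) (scale_seq t) ?D g0"
    "\<And>a x. a \<in> P \<Longrightarrow> x \<in> fib (kmod I) a \<Longrightarrow> f a (g0 a x) = f a (summand_incl i (e a x))"
    "\<And>a x. a \<in> P \<Longrightarrow> x \<in> fib (kmod I) a \<Longrightarrow> f a (summand_incl i (e a x)) = 0 \<Longrightarrow> g0 a x = 0"
    by (rule interval_cover_lift_kernel[OF cover I pmod_hom_comp[OF he fi]]) (rule that)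
  define g where "g a x = g0 a (e' a x)" for a x
  have g: "pmod_hom P t (X i) (scale_seq t) ?D g"
    unfolding g_def using pmod_hom_comp[OF he' g0(1)] .
  have fg: "f a (g a x) = f a (summand_incl i x)" if "a \<in> P" "x \<in> fib (X i) a" for a x
    using that g0(2) pmod_hom_in[OF he'] ee' by (simp add: g_def)
  have g_zero: "g a x = 0" if "a \<in> P" "x \<in> fib (X i) a" "f a (summand_incl i x) = 0" for a x
    using that g0(3) pmod_hom_in[OF he'] ee' by (simp add: g_def)
  \<comment> \<open>Since \<open>g\<close> lifts the restriction of \<open>f\<close> to the
    \<open>i\<close>-th summand, exchanging the inclusion of that summand for \<open>g\<close> does
    not change the composite with \<open>f\<close>.\<close>
  define q where "q a x = x(i := 0) + g a (x i)" for a x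
  have q: "pmod_hom P (scale_seq t) ?D (scale_seq t) ?D q"
    unfolding q_def using direct_sum_replace_summand_hom[OF pX g D i] .
  have "f a (q a x) = f a x" if a: "a \<in> P" and x: "x \<in> fib ?D a" for a x
  proof -
    have xi: "x i \<in> fib (X i) a" and x0: "x(i := 0) \<in> fib ?D a"
      using x i pmodule_fib_zero[OF pX a] by (auto simp: direct_sum_def)
    have "f a (q a x) = f a (x(i := 0)) + f a (summand_incl i (x i))"
      using pmod_hom_add[OF f a x0 pmod_hom_in[OF g a xi]] fg[OF a xi] by (simp add: q_def)
    also have "\<dots> = f a (x(i := 0) + summand_incl i (x i))"
      using pmod_hom_add[OF f a x0 pmod_hom_in[OF incl a xi]] by simp
    also have "x(i := 0) + summand_incl i (x i) = x"
      by (auto simp: summand_incl_def fun_eq_iff)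
    finally show ?thesis .
  qed
  then have "pmod_iso P (scale_seq t) ?D (scale_seq t) ?D q"
    using cover q by (simp add: interval_cover_def)
  then have inj: "inj_on (q a) (fib ?D a)" if "a \<in> P" for a
    using that by (simp add: pmod_iso_def pmod_inj_def)
  show ?thesis
  proof (rule pmod_injI[OF fi pX[OF i]])
    fix a x assume *: "a \<in> P" "x \<in> fib (X i) a" "f a (summand_incl i x) = 0"
    \<comment> \<open>Zeroing coordinate \<open>i\<close> leaves nothing of
      \<open>summand_incl i x\<close>, and \<open>g\<close> kills the kernel vector
      \<open>x\<close>. Injectivity of \<open>q a\<close> then gives \<open>x = 0\<close>.\<close>
    have "q a (summand_incl i x) = 0"
      using g_zero[OF *] by (auto simp: q_def summand_incl_def fun_eq_iff)
    also have "0 = q a 0"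
      using pmod_hom_zero[OF q D *(1)] by simp
    finally have "summand_incl i x = 0"
      using inj_onD[OF inj[OF *(1)]] pmod_hom_in[OF incl *(1,2)] pmodule_fib_zero[OF D *(1)] by blast
    then have "summand_incl i x i = 0" by simp
    then show "x = 0" by (simp add: summand_incl_def)
  qed
qed

section \<open>Replacing the summands by their images in \<open>M\<close>, and the theorem\<close>

lemma pmod_iso_direct_sum:
  assumes "\<And>i. i < m \<Longrightarrow> pmod_iso P t (X i) s (N i) (q i)" and s: "vector_space s"
  shows "pmod_iso P (scale_seq t) (direct_sum m X) (scale_seq s) (direct_sum m N)
    (\<lambda>a x i. if i < m then q i a (x i) else 0)" (is "pmod_iso _ _ ?X _ ?N ?q")
proof -
  have q: "pmod_hom P t (X i) s (N i) (q i)"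
    and bij: "\<And>a. a \<in> P \<Longrightarrow> inj_on (q i a) (fib (X i) a)"
      "\<And>a. a \<in> P \<Longrightarrow> q i a ` fib (X i) a = fib (N i) a"
    if "i < m" for i
    using assms(1)[OF that] by (simp_all add: pmod_iso_def pmod_inj_def pmod_surj_def)
  have s: "module s" using s by (rule vector_space_imp_module)
  have hom: "pmod_hom P (scale_seq t) ?X (scale_seq s) ?N ?q"
    using pmod_homD[OF q]
    by (intro pmod_homI linear_betweenI)
      (auto simp: direct_sum_def scale_seq_def fun_eq_iff module.scale_zero_right[OF s])
  moreover have "pmod_inj P ?X ?q"
    unfolding pmod_inj_def
  proof (intro ballI inj_onI ext)
    fix a x y i assume *: "a \<in> P" "x \<in> fib ?X a" "y \<in> fib ?X a" "?q a x = ?q a y"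
    show "x i = y i"
    proof (cases "i < m")
      case True
      then show ?thesis
        using * fun_cong[OF *(4), of i] inj_onD[OF bij(1)] by (auto simp: direct_sum_def)
    qed (use * in \<open>simp add: direct_sum_def\<close>)
  qed
  moreover have "pmod_surj P ?X ?N ?q"
    unfolding pmod_surj_def
  proof (intro ballI equalityI subsetI)
    fix a y assume a: "a \<in> P" and y: "y \<in> fib ?N a"
    have "\<forall>i\<in>{..<m}. \<exists>z. z \<in> fib (X i) a \<and> q i a z = y i"
    proof
      fix i assume "i \<in> {..<m}"
      then have i: "i < m" and "y i \<in> fib (N i) a"
        using y by (simp_all add: direct_sum_def)
      then have "y i \<in> q i a ` fib (X i) a"
        by (simp only: bij(2)[OF i a])
      then show "\<exists>z. z \<in> fib (X i) a \<and> q i a z = y i" by (simp only: image_iff) metis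
    qed
    from bchoice[OF this] obtain z where z: "\<forall>i\<in>{..<m}. z i \<in> fib (X i) a \<and> q i a (z i) = y i" ..
    let ?x = "\<lambda>i. if i < m then z i else 0"
    have "y = ?q a ?x"
      using z y by (simp add: direct_sum_def fun_eq_iff)
    moreover have "?x \<in> fib ?X a"
      using z by (simp add: direct_sum_def)
    ultimately show "y \<in> ?q a ` fib ?X a"
      by (rule image_eqI[where f = "?q a" and x = ?x])
  next
    fix a y assume "a \<in> P" "y \<in> ?q a ` fib ?X a"
    then show "y \<in> fib ?N a"
      using pmod_hom_in[OF hom] by (elim imageE) simp
  qed
  ultimately show ?thesis by (simp add: pmod_iso_def)
qed

theorem theorem1p1:
  fixes P :: "'p::order set"
    and s :: "'k::field \<Rightarrow> 'v::ab_group_add \<Rightarrow> 'v" and M :: "('p, 'v) pmod"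
    and t :: "'k \<Rightarrow> 'w::ab_group_add \<Rightarrow> 'w" and X :: "nat \<Rightarrow> ('p, 'w) pmod"
    and m :: nat and f :: "'p \<Rightarrow> (nat \<Rightarrow> 'w) \<Rightarrow> 'v"
  assumes "finite P"
    and "pmodule P s M"
    and "\<And>i. i < m \<Longrightarrow> interval_module P t (X i)"
    and "interval_cover P (scale_seq t) (direct_sum m X) s M f"
  shows "pmod_surj P (direct_sum m X) M f
    \<and> (\<forall>i<m. pmod_inj P (X i) (\<lambda>a x. f a (summand_incl i x)))
    \<and> support P M = support P (direct_sum m X)
    \<and> (\<exists>N :: nat \<Rightarrow> ('p, 'v) pmod.
         (\<forall>i<m. submodule P s (N i) M \<and> interval_module P s (N i) \<and>
                pmod_iso P t (X i) s (N i) (\<lambda>a x. f a (summand_incl i x))) \<and>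
         interval_cover P (scale_seq s) (direct_sum m N) s M (\<lambda>a x. \<Sum>i<m. x i))"
proof -
  note M = assms(2) and X = assms(3) and cover = assms(4)
  let ?D = "direct_sum m X"
  define q where "q i a x = f a (summand_incl i x)" for i a x
  have s: "vector_space s" using M by (simp add: pmodule_def)
  have pX: "\<And>i. i < m \<Longrightarrow> pmodule P t (X i)"
    using X by (simp add: interval_module_def)
  have D: "pmodule P (scale_seq t) ?D" and f: "pmod_hom P (scale_seq t) ?D s M f"
    using cover by (simp_all add: interval_cover_def interval_decomposable_def)
  have surj: "pmod_surj P ?D M f"
    using cover by (rule interval_cover_surj)
  have inj: "pmod_inj P (X i) (q i)" if "i < m" for i
    unfolding q_def using interval_cover_summand_inj[OF cover X that] .
  have incl: "pmod_hom P t (X i) (scale_seq t) ?D (\<lambda>a. summand_incl i)" if "i < m" for i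
    using that pX by (rule summand_incl_hom)
  have q: "pmod_hom P t (X i) s M (q i)" if "i < m" for i
    unfolding q_def using pmod_hom_comp[OF incl[OF that] f] .
  \<comment> \<open>Splitting a vector into its coordinates recovers \<open>f\<close> from its
    restrictions to the summands.\<close>
  have f_sum: "f a x = (\<Sum>i<m. q i a (x i))" if a: "a \<in> P" and x: "x \<in> fib ?D a" for a x
  proof -
    have f_lin: "linear_between (scale_seq t) (fib ?D a) s (fib M a) (f a)"
        "module (scale_seq t)" "module.subspace (scale_seq t) (fib ?D a)"
      using f D a pmodule_module by (auto simp: pmod_hom_def pmodule_def vector_space_imp_module)
    have "f a x = f a (\<Sum>i<m. summand_incl i (x i))"
      using direct_sum_decomp[OF x] by simp
    also have "\<dots> = (\<Sum>i<m. q i a (x i))"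
      unfolding q_def using x pmod_hom_in[OF incl a]
      by (intro linear_between_sum[OF f_lin]) (auto simp: direct_sum_def)
    finally show ?thesis .
  qed
  \<comment> \<open>A zero fibre of the direct sum has zero image, which is all of
    \<open>fib M a\<close> by surjectivity. Conversely, over a zero fibre of \<open>M\<close>
    injectivity on the summands makes every coordinate zero.\<close>
  have supp: "fib M a = {0} \<longleftrightarrow> fib ?D a = {0}" if a: "a \<in> P" for a
  proof
    assume "fib ?D a = {0}"
    then show "fib M a = {0}"
      using surj a pmod_hom_zero[OF f D a] by (simp add: pmod_surj_def) (metis image_empty image_insert)
  next
    assume M0: "fib M a = {0}"
    have "x = 0" if x: "x \<in> fib ?D a" for x
    proof
      fix i
      show "x i = 0 i"
      proof (cases "i < m")
        case True
        then have "x i \<in> fib (X i) a" using x by (simp add: direct_sum_def)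
        moreover have "q i a (x i) = q i a 0"
          using pmod_hom_in[OF q[OF True] a] pmodule_fib_zero[OF pX[OF True] a] calculation M0 by simp
        ultimately show ?thesis
          using inj[OF True] a pmodule_fib_zero[OF pX[OF True] a] by (auto simp: pmod_inj_def inj_on_def)
      qed (use x in \<open>simp add: direct_sum_def\<close>)
    qed
    then show "fib ?D a = {0}"
      using pmodule_fib_zero[OF D a] by blast
  qed
  \<comment> \<open>The image of the \<open>i\<close>-th summand. Its transition maps can be those
    of \<open>M\<close> unchanged, because only their values on the fibres matter.\<close>
  define N where "N i = \<lparr>fib = (\<lambda>a. q i a ` fib (X i) a), tr = tr M\<rparr>" for i
  have iso: "pmod_iso P t (X i) s (N i) (q i)" if "i < m" for i
    using q[OF that] inj[OF that]
    by (auto simp: pmod_iso_def pmod_surj_def pmod_hom_def linear_between_def N_def)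
  have N: "pmodule P s (N i)" if "i < m" for i
    by (rule pmodule_surj_image[OF pX[OF that] s, where g = "q i"])
      (use iso[OF that] in \<open>simp_all add: pmod_iso_def\<close>)
  have "submodule P s (N i) M" if "i < m" for i
    using N[OF that] pmod_hom_in[OF q[OF that]] by (auto simp: submodule_def N_def)
  moreover have "interval_module P s (N i)" if "i < m" for i
    using N[OF that] X[OF that] pmod_iso_comp[OF _ iso[OF that]] unfolding interval_module_def by blast
  \<comment> \<open>Along the direct sum of the \<open>q i\<close>, the given cover \<open>f\<close>
    turns into addition of coordinates by \<open>f_sum\<close>; so the cover property is transported
    rather than proved anew.\<close>
  moreover have "interval_cover P (scale_seq s) (direct_sum m N) s M (\<lambda>a x. \<Sum>i<m. x i)"
  proof (rule interval_cover_iso[OF cover])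
    show "vector_space (scale_seq s)" using s by (rule vector_space_scale_seq)
    show "pmod_iso P (scale_seq t) ?D (scale_seq s) (direct_sum m N)
        (\<lambda>a x i. if i < m then q i a (x i) else 0)"
      using iso s by (rule pmod_iso_direct_sum)
    show "(\<Sum>i<m. if i < m then q i a (x i) else 0) = f a x" if "a \<in> P" "x \<in> fib ?D a" for a x
      using f_sum[OF that] by simp
    interpret M: vector_space s by fact
    have fibN: "y \<in> fib M a" if "a \<in> P" "i < m" "y \<in> fib (N i) a" for a i y
      using that pmod_hom_in[OF q] by (auto simp: N_def)
    have sum_in: "(\<Sum>i<m. x i) \<in> fib M a" if "a \<in> P" "x \<in> fib (direct_sum m N) a" for a x
      using M that fibN by (intro M.subspace_sum) (auto simp: pmodule_def direct_sum_def)
    have tr_sum: "(\<Sum>i<m. tr M a b (x i)) = tr M a b (\<Sum>i<m. x i)"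
      if ab: "a \<in> P" "b \<in> P" "a \<le> b" and x: "x \<in> fib (direct_sum m N) a" for a b x
    proof -
      have "linear_between s (fib M a) s (fib M b) (tr M a b)" "M.subspace (fib M a)"
        using M ab by (simp_all add: pmodule_def)
      then show ?thesis
        using linear_between_sum[of s _ s _ _ "{..<m}" x] x ab(1) fibN M.module_axioms
        by (simp add: direct_sum_def)
    qed
    show "pmod_hom P (scale_seq s) (direct_sum m N) s M (\<lambda>a x. \<Sum>i<m. x i)"
      using sum_in tr_sum
      by (intro pmod_homI linear_betweenI)
        (auto simp: scale_seq_def sum.distrib M.scale_sum_right direct_sum_def N_def)
  qed
  moreover have "support P M = support P ?D"
    using supp by (simp add: support_def cong: conj_cong)
  ultimately show ?thesis
    using surj inj iso unfolding q_def
    by (intro conjI exI[of _ N]) auto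
qed

end
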